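(* Let $G$ be a connected graph containing at least one even cycle. Then: (a) $\chi(G)\leq \ell_e(G)+1$; (b) if $w(G)\leq \ell_e(G)$ and $|L_e(G)|\geq 3$, then $\chi(G)\leq \ell_e(G)$; (c) if $w(G)\leq \ell_e(G)-1$ and $|L_e(G)|\geq 3$, then $\chi(G)\leq \ell_e(G)-1$.
   Context: All graphs are finite, simple and undirected. $L_e(G)$ denotes the set of all even integers $m$ such that $G$ contains a cycle of length $m$, and $\ell_e(G)$ denotes the length of a longest even cycle in $G$. $w(G)$ denotes the clique number of $G$ (the number of vertices of a largest clique) and $\chi(G)$ the chromatic number. *)

theory Defs
  imports "Graph_Theory.Graph_Theory"
begin

text \<open>
  A finite simple undirected graph is a symmetric loop-free digraph whose arcs are
  pairs of vertices (\<open>pair_graph\<close>): each edge is represented by its two opposite arcs.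
\<close>

text \<open>
  In this encoding every edge gives a closed arc walk of length 2, which
  \<open>pre_digraph.cycle\<close> admits; it is not a cycle of the undirected graph.
  The length of a cycle is the number of its arcs.
\<close>
definition ugraph_cycle :: "'a pair_pre_digraph \<Rightarrow> ('a \<times> 'a) awalk \<Rightarrow> bool" where
  "ugraph_cycle G p \<longleftrightarrow> pre_digraph.cycle (with_proj G) p \<and> 3 \<le> length p"

definition even_cycle_lengths :: "'a pair_pre_digraph \<Rightarrow> nat set" where
  "even_cycle_lengths G = {m. even m \<and> (\<exists>p. ugraph_cycle G p \<and> length p = m)}"

definition longest_even_cycle :: "'a pair_pre_digraph \<Rightarrow> nat" where
  "longest_even_cycle G = Max (even_cycle_lengths G)"

definition is_clique :: "'a pair_pre_digraph \<Rightarrow> 'a set \<Rightarrow> bool" where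
  "is_clique G K \<longleftrightarrow> K \<subseteq> pverts G \<and> (\<forall>u\<in>K. \<forall>v\<in>K. u \<noteq> v \<longrightarrow> (u, v) \<in> parcs G)"

definition clique_number :: "'a pair_pre_digraph \<Rightarrow> nat" where
  "clique_number G = Max {card K | K. is_clique G K}"

definition proper_coloring :: "'a pair_pre_digraph \<Rightarrow> nat \<Rightarrow> ('a \<Rightarrow> nat) \<Rightarrow> bool" where
  "proper_coloring G k c \<longleftrightarrow>
     (\<forall>v\<in>pverts G. c v < k) \<and> (\<forall>(u, v)\<in>parcs G. c u \<noteq> c v)"

definition chromatic_number :: "'a pair_pre_digraph \<Rightarrow> nat" where
  "chromatic_number G = (LEAST k. \<exists>c. proper_coloring G k c)"

text \<open>
  On finite simple graphs the maxima and the minimum above are attained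
  (the first one provided there is an even cycle).
\<close>

lemma (in pair_graph) finite_even_cycle_lengths: "finite (even_cycle_lengths G)"
proof (rule finite_subset)
  show "even_cycle_lengths G \<subseteq> {..card (parcs G)}"
  proof
    fix m assume "m \<in> even_cycle_lengths G"
    then obtain p where p: "cycle p" "length p = m"
      by (auto simp: even_cycle_lengths_def ugraph_cycle_def)
    then obtain u where "awalk u p u" "distinct p"
      unfolding cycle_conv by blast
    then have "distinct p" "set p \<subseteq> parcs G"
      unfolding awalk_def by simp_all
    then have "length p \<le> card (parcs G)"
      using card_mono[OF pair_finite_arcs, of "set p"] by (simp add: distinct_card)
    with p show "m \<in> {..card (parcs G)}" by simp
  qed
qed simp

lemma (in pair_graph) longest_even_cycle_in:
  assumes "even_cycle_lengths G \<noteq> {}"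
  shows "longest_even_cycle G \<in> even_cycle_lengths G"
  unfolding longest_even_cycle_def
  using finite_even_cycle_lengths assms by (rule Max_in)

lemma (in pair_graph) clique_number_attained:
  "\<exists>K. is_clique G K \<and> card K = clique_number G"
proof -
  let ?S = "{card K | K. is_clique G K}"
  have "?S \<subseteq> card ` Pow (pverts G)"
    by (auto simp: is_clique_def)
  then have "finite ?S"
    by (rule finite_subset) (simp add: pair_finite_verts)
  moreover have "is_clique G {}"
    by (simp add: is_clique_def)
  then have "?S \<noteq> {}" by blast
  ultimately have "Max ?S \<in> ?S" by (rule Max_in)
  then show ?thesis by (auto simp: clique_number_def)
qed

lemma (in pair_graph) chromatic_number_attained:
  "\<exists>c. proper_coloring G (chromatic_number G) c"
proof -
  obtain f :: "'a \<Rightarrow> nat" where f: "bij_betw f (pverts G) {0..<card (pverts G)}"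
    using ex_bij_betw_finite_nat pair_finite_verts by blast
  have "f u \<noteq> f v" if "(u, v) \<in> parcs G" for u v
  proof -
    have "u \<in> pverts G" "v \<in> pverts G" "u \<noteq> v"
      using that by (auto dest: in_arcsD1 in_arcsD2 no_loops')
    with f show ?thesis by (auto simp: bij_betw_def inj_on_def)
  qed
  moreover have "f v < card (pverts G)" if "v \<in> pverts G" for v
    using that f by (auto simp: bij_betw_def)
  ultimately have "proper_coloring G (card (pverts G)) f"
    by (auto simp: proper_coloring_def)
  then show ?thesis
    unfolding chromatic_number_def
    using LeastI[of "\<lambda>k. \<exists>c. proper_coloring G k c"] by blast
qed

end

theory Submission
  imports Defs
begin

text \<open>
  Let \<open>l\<close> be the length of a longest even cycle and \<open>W\<close> a minimal set of vertices that is not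
  \<open>k\<close>-colourable; every vertex of \<open>W\<close> has at least \<open>k\<close> neighbours in \<open>W\<close>, and \<open>W\<close> has no cut vertex.
  Take a longest path \<open>p\<^sub>0 p\<^sub>1 \<dots>\<close> in \<open>W\<close> such that the last neighbour \<open>p\<^sub>M\<close> of the start is as far away
  as possible. All neighbours of \<open>p\<^sub>0\<close> lie on the path. Those at odd positions are at positions
  below \<open>l\<close>; if \<open>M\<close> is even, those at even positions are above
  \<open>M - l\<close>, because two chords at \<open>p\<^sub>0\<close> close up an even cycle; if \<open>M\<close> is odd,
  then \<open>M < l\<close>. So \<open>k \<le> l\<close>.
  If \<open>k \<ge> l - 1\<close>, at most one of the \<open>l\<close> possible positions is free. Comparing \<open>p\<^sub>0\<close> with
  the start of a rotated path gives \<open>M \<le> l\<close>, and then, by further rotations, \<open>p\<^sub>M\<close> separates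
  \<open>p\<^sub>0, \<dots>, p\<^bsub>M-1\<^esub>\<close> from the rest of \<open>W\<close>. Hence \<open>W = {p\<^sub>0, \<dots>, p\<^sub>M}\<close> has at most \<open>l + 1\<close> elements,
  and as its degrees are so large it contains the required clique.
\<close>

lemma successively_upt:
  assumes "\<And>i. a \<le> i \<Longrightarrow> Suc i < b \<Longrightarrow> R i (Suc i)"
  shows "successively R [a..<b]"
  using assms by (simp add: successively_conv_nth)

section \<open>Colourings and critical vertex sets of a symmetric irreflexive relation\<close>

locale adjacency =
  fixes E :: "'a \<Rightarrow> 'a \<Rightarrow> bool"
  assumes sym: "E u v \<Longrightarrow> E v u"
    and irrefl: "\<not> E u u"
begin

definition path :: "'a set \<Rightarrow> 'a list \<Rightarrow> bool" where
  "path V p \<longleftrightarrow> p \<noteq> [] \<and> distinct p \<and> set p \<subseteq> V \<and> successively E p"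

definition cyc :: "'a list \<Rightarrow> bool" where
  "cyc p \<longleftrightarrow> 3 \<le> length p \<and> distinct p \<and> successively E p \<and> E (last p) (hd p)"

definition colorable :: "'a set \<Rightarrow> nat \<Rightarrow> bool" where
  "colorable V k \<longleftrightarrow> (\<exists>c. (\<forall>v\<in>V. c v < k) \<and> (\<forall>u\<in>V. \<forall>v\<in>V. E u v \<longrightarrow> c u \<noteq> c v))"

definition critical :: "'a set \<Rightarrow> nat \<Rightarrow> bool" where
  "critical V k \<longleftrightarrow> finite V \<and> \<not> colorable V k \<and> (\<forall>W. W \<subset> V \<longrightarrow> colorable W k)"

lemma critical_subset_exists:
  assumes "finite V" "\<not> colorable V k"
  obtains W where "W \<subseteq> V" "critical W k"
proof -
  let ?P = "\<lambda>W. W \<subseteq> V \<and> \<not> colorable W k"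
  obtain W where W: "?P W" "\<And>W'. ?P W' \<Longrightarrow> card W \<le> card W'"
    using ex_has_least_nat[of ?P V card] assms by blast
  have "finite W" using W(1) assms(1) finite_subset by blast
  moreover have "colorable W' k" if "W' \<subset> W" for W'
    using W that \<open>finite W\<close> psubset_card_mono[of W W'] by (meson leD order.trans psubset_imp_subset)
  ultimately show ?thesis using W(1) that by (auto simp: critical_def)
qed

lemma critical_nonempty: "critical V k \<Longrightarrow> V \<noteq> {}"
  by (auto simp: critical_def colorable_def)

text \<open>With fewer than \<open>k\<close> neighbours of \<open>v\<close>, a colouring of
  \<open>V - {v}\<close> leaves some colour free for \<open>v\<close>.\<close>

lemma critical_min_degree:
  assumes "critical V k" "v \<in> V"
  shows "k \<le> card {u \<in> V. E v u}"
proof (rule ccontr)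
  assume less: "\<not> ?thesis"
  have fin: "finite V" using assms(1) by (simp add: critical_def)
  have "colorable (V - {v}) k" using assms by (auto simp: critical_def)
  then obtain c where c: "\<forall>u\<in>V - {v}. c u < k" "\<forall>u\<in>V - {v}. \<forall>w\<in>V - {v}. E u w \<longrightarrow> c u \<noteq> c w"
    unfolding colorable_def by blast
  have "card (c ` {u \<in> V. E v u}) < card {..<k}"
    using less card_image_le[of "{u \<in> V. E v u}" c] fin by simp
  then have "\<not> {..<k} \<subseteq> c ` {u \<in> V. E v u}"
    using card_mono[of "c ` {u \<in> V. E v u}" "{..<k}"] fin by auto
  then obtain a where a: "a < k" "a \<notin> c ` {u \<in> V. E v u}" by blast
  have "c u \<noteq> a" if "u \<in> V" "E v u \<or> E u v" for u
    using a(2) that sym[of u v] by blast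
  then have "colorable V k"
    unfolding colorable_def
    using a(1) c irrefl by (intro exI[of _ "c(v := a)"]) auto
  then show False using assms(1) by (simp add: critical_def)
qed

lemma colorable_glue:
  assumes A: "colorable A k" and B: "colorable B k" and AB: "A \<inter> B = {x}"
    and no_edge: "\<And>u v. u \<in> A - {x} \<Longrightarrow> v \<in> B - {x} \<Longrightarrow> \<not> E u v"
  shows "colorable (A \<union> B) k"
proof -
  obtain c where c: "\<forall>v\<in>A. c v < k" "\<forall>u\<in>A. \<forall>v\<in>A. E u v \<longrightarrow> c u \<noteq> c v"
    using A by (auto simp: colorable_def)
  obtain d where d: "\<forall>v\<in>B. d v < k" "\<forall>u\<in>B. \<forall>v\<in>B. E u v \<longrightarrow> d u \<noteq> d v"
    using B by (auto simp: colorable_def)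
  \<comment> \<open>Swapping two colours throughout \<open>B\<close> keeps its colouring proper and
    makes it agree with \<open>c\<close> at the only common vertex \<open>x\<close>.\<close>
  define t where "t = Transposition.transpose (d x) (c x)"
  define e where "e = (\<lambda>v. if v \<in> A then c v else t (d v))"
  have x: "x \<in> A" "x \<in> B" using AB by auto
  have eA: "e v = c v" if "v \<in> A" for v
    using that by (simp add: e_def)
  have eB: "e v = t (d v)" if "v \<in> B" for v
    using that AB by (cases "v = x") (auto simp: e_def t_def)
  have inj: "t a = t b \<longleftrightarrow> a = b" for a b by (simp add: t_def inj_eq)
  have "e v < k" if "v \<in> A \<union> B" for v
    using that c(1) d(1) x by (auto simp: e_def t_def Transposition.transpose_def)
  moreover have "e u \<noteq> e v" if uv: "u \<in> A \<union> B" "v \<in> A \<union> B" "E u v" for u v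
  proof -
    consider "u \<in> A" "v \<in> A" | "u \<in> B" "v \<in> B" 
      using no_edge[of u v] no_edge[of v u] uv sym[OF uv(3)] x by blast
    then show ?thesis
      using c(2) d(2) uv(3) by cases (simp_all add: eA eB inj)
  qed
  ultimately show ?thesis unfolding colorable_def by blast
qed

text \<open>Otherwise \<open>X\<close> and the rest of \<open>V\<close> together with
  \<open>x\<close> are both proper subsets, hence colourable, and meet only in \<open>x\<close>;
  gluing would colour \<open>V\<close>.\<close>

lemma critical_no_cutvertex:
  assumes crit: "critical V k" and X: "X \<subseteq> V" "x \<in> X" "X \<noteq> {x}"
    and closed: "\<And>u v. u \<in> X - {x} \<Longrightarrow> v \<in> V \<Longrightarrow> E u v \<Longrightarrow> v \<in> X"
  shows "X = V"
proof (rule ccontr)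
  assume "X \<noteq> V"
  then have "X \<subset> V" using X(1) by blast
  define B where "B = V - (X - {x})"
  obtain y where y: "y \<in> X" "y \<noteq> x" using X by blast
  then have "y \<in> V" "y \<notin> B" using X(1) by (auto simp: B_def)
  then have "B \<subset> V" by (auto simp: B_def)
  have "colorable (X \<union> B) k"
  proof (rule colorable_glue[where x = x])
    show "colorable X k" "colorable B k"
      using crit \<open>X \<subset> V\<close> \<open>B \<subset> V\<close> by (simp_all add: critical_def)
    show "X \<inter> B = {x}" using X(1,2) by (auto simp: B_def)
    show "\<not> E u v" if "u \<in> X - {x}" "v \<in> B - {x}" for u v
      using closed[OF that(1)] that(2) by (auto simp: B_def)
  qed
  moreover have "X \<union> B = V" using X by (auto simp: B_def)
  ultimately show False using crit by (simp add: critical_def)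
qed

section \<open>Rearranging a path by lists of positions\<close>

lemma path_nth_adj: "path V p \<Longrightarrow> Suc i < length p \<Longrightarrow> E (p ! i) (p ! Suc i)"
  by (simp add: path_def successively_conv_nth)

text \<open>Rotations and cycles are given below as lists of positions in one fixed path, so that
  distinctness and length are facts about intervals of numbers.\<close>

lemma path_reindex:
  assumes "path V p" "js \<noteq> []" "distinct js" "set js \<subseteq> {..<length p}"
    "successively (\<lambda>i j. E (p ! i) (p ! j)) js"
  shows "path V (map ((!) p) js)"
  using assms by (auto simp: path_def successively_map distinct_map inj_on_nth subset_iff)

lemma cyc_reindex:
  assumes "path V p" "3 \<le> length js" "distinct js" "set js \<subseteq> {..<length p}"
    "successively (\<lambda>i j. E (p ! i) (p ! j)) js" "E (p ! last js) (p ! hd js)"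
  shows "cyc (map ((!) p) js)"
proof -
  have "js \<noteq> []" using assms(2) by auto
  then show ?thesis using assms path_reindex[of V p js]
    by (auto simp: cyc_def path_def hd_map last_map)
qed

lemma path_successively_upt:
  "path V p \<Longrightarrow> b \<le> length p \<Longrightarrow> successively (\<lambda>i j. E (p ! i) (p ! j)) [a..<b]"
  by (rule successively_upt) (simp add: path_nth_adj)

lemma path_successively_rev_upt:
  "path V p \<Longrightarrow> b \<le> length p \<Longrightarrow> successively (\<lambda>i j. E (p ! i) (p ! j)) (rev [a..<b])"
  unfolding successively_rev by (rule successively_upt) (simp add: path_nth_adj sym[OF path_nth_adj])

section \<open>Longest paths, the neighbours of their start, and rotations\<close>

definition nbr_pos :: "'a list \<Rightarrow> nat set" where
  "nbr_pos p = {i. i < length p \<and> E (p ! 0) (p ! i)}"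

lemma nbr_pos_ge1: "i \<in> nbr_pos p \<Longrightarrow> 1 \<le> i"
  using irrefl by (cases i) (auto simp: nbr_pos_def)

text \<open>The bound \<open>M\<close> ranges over all longest paths of \<open>V\<close>, so it
  carries over to every rearrangement of \<open>p\<close>.\<close>

definition extremal :: "'a set \<Rightarrow> 'a list \<Rightarrow> nat \<Rightarrow> bool" where
  "extremal V p M \<longleftrightarrow> path V p \<and> M \<in> nbr_pos p
    \<and> (\<forall>q. path V q \<longrightarrow> length q \<le> length p)
    \<and> (\<forall>q i. path V q \<and> length q = length p \<and> i \<in> nbr_pos q \<longrightarrow> i \<le> M)"

lemma path_length_le: "finite V \<Longrightarrow> path V p \<Longrightarrow> length p \<le> card V"
  by (metis card_mono distinct_card path_def)

text \<open>A neighbour off the path could be put in front of it.\<close>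

lemma longest_path_nbrs:
  assumes longest: "\<And>q. path V q \<Longrightarrow> length q \<le> length p" and p: "path V p"
    and u: "u \<in> V" "E (p ! 0) u"
  shows "\<exists>i\<in>nbr_pos p. u = p ! i"
proof -
  have "u \<in> set p"
  proof (rule ccontr)
    assume "u \<notin> set p"
    then have "path V (u # p)"
      using p u sym[OF u(2)] by (auto simp: path_def successively_Cons hd_conv_nth)
    then show False using longest by fastforce
  qed
  then show ?thesis using u by (auto simp: in_set_conv_nth nbr_pos_def)
qed

lemma extremal_exists:
  assumes "finite V" "V \<noteq> {}" and nbr: "\<And>v. v \<in> V \<Longrightarrow> \<exists>u\<in>V. E v u"
  obtains p M where "extremal V p M"
proof -
  obtain v where "v \<in> V" using assms(2) by blast
  then have "path V [v]" by (simp add: path_def)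
  then obtain p where p: "path V p" "\<And>q. path V q \<Longrightarrow> length q \<le> length p"
    using ex_has_greatest_nat[of "path V" "[v]" length "Suc (card V)"] path_length_le[OF assms(1)]
    by (metis less_Suc_eq_le)
  have "p ! 0 \<in> V" using p(1) by (auto simp: path_def)
  then obtain i where i: "i \<in> nbr_pos p"
    using nbr longest_path_nbrs[OF p(2) p(1)] by blast
  let ?P = "\<lambda>(q, i). path V q \<and> length q = length p \<and> i \<in> nbr_pos q"
  have "\<forall>y. ?P y \<longrightarrow> snd y < length p"
    by (auto simp: nbr_pos_def)
  then obtain x where x: "?P x" "\<forall>y. ?P y \<longrightarrow> snd y \<le> snd x"
    using ex_has_greatest_nat[of ?P "(p, i)" snd "length p"] p i by auto
  then have "extremal V (fst x) (snd x)"
    using p by (auto simp: extremal_def split: prod.splits)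
  then show ?thesis by (rule that)
qed

lemma extremal_start_nbrs:
  assumes "extremal V p M" "path V q" "length q = length p" "u \<in> V" "E (q ! 0) u"
  shows "\<exists>i\<in>nbr_pos q. i \<le> M \<and> u = q ! i"
  using longest_path_nbrs[of V q u] assms unfolding extremal_def by metis

lemma extremal_nbr_pos_card:
  assumes "extremal V p M" "path V q" "length q = length p"
    and deg: "d \<le> card {u \<in> V. E (q ! 0) u}"
  shows "nbr_pos q \<subseteq> {1..M}" "d \<le> card (nbr_pos q)"
proof -
  show sub: "nbr_pos q \<subseteq> {1..M}"
    using assms(1-3) nbr_pos_ge1 unfolding extremal_def by fastforce
  have "{u \<in> V. E (q ! 0) u} \<subseteq> (!) q ` nbr_pos q"
    using extremal_start_nbrs[OF assms(1-3)] by blast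
  then have "card {u \<in> V. E (q ! 0) u} \<le> card (nbr_pos q)"
    using sub by (meson finite_atLeastAtMost finite_subset surj_card_le)
  then show "d \<le> card (nbr_pos q)" using deg by linarith
qed

text \<open>
  The rearranged path is again a longest one, so \<open>M\<close> also bounds the positions of the neighbours of its
  start; and its first \<open>M + 1\<close> vertices are the same set.
\<close>
lemma extremal_rearranged_start:
  assumes ext: "extremal V p M" and ks: "ks \<noteq> []" "distinct ks" "set ks = {..<M}"
    and succ: "successively (\<lambda>i j. E (p ! i) (p ! j)) (ks @ [M..<length p])"
    and u: "u \<in> V" "E (p ! hd ks) u"
  shows "u \<in> (!) p ` {..M}"
proof -
  have p: "path V p" and M: "M < length p" using ext by (auto simp: extremal_def nbr_pos_def)
  have len: "length ks = M" using ks(2,3) by (metis card_lessThan distinct_card)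
  have ks_less: "i < M" if "i \<in> set ks" for i using that ks(3) by simp
  define q where "q = map ((!) p) (ks @ [M..<length p])"
  have q: "path V q" unfolding q_def
  proof (rule path_reindex[OF p _ _ _ succ])
    show "distinct (ks @ [M..<length p])" using ks(2) ks_less by fastforce
    show "set (ks @ [M..<length p]) \<subseteq> {..<length p}" using ks_less M by fastforce
  qed (use ks(1) in simp)
  have "length q = length p" using len M by (simp add: q_def)
  moreover have "q ! 0 = p ! hd ks" using ks(1) by (simp add: q_def nth_append hd_conv_nth)
  ultimately obtain i where i: "i \<le> M" "u = q ! i"
    using extremal_start_nbrs[OF ext q] u by auto
  show ?thesis
  proof (cases "i = M")
    case True
    then show ?thesis using i len M by (simp add: q_def nth_append)
  next
    case False
    then have "i < length ks" using i len by simp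
    then have "u = p ! (ks ! i)" "ks ! i < M"
      using i(2) ks_less[OF nth_mem] by (simp_all add: q_def nth_append)
    then show ?thesis by simp
  qed
qed

text \<open>The edge from \<open>p ! 0\<close> to \<open>p ! i\<close> allows the first
  \<open>i\<close> vertices to be reversed. The new path starts at \<open>p ! (i - 1)\<close> and is
  unchanged from position \<open>M\<close> on.\<close>

lemma extremal_rotated_start:
  assumes ext: "extremal V p M" and i: "i \<in> nbr_pos p"
    and u: "u \<in> V" "E (p ! (i - 1)) u"
  shows "u \<in> (!) p ` {..M}"
proof -
  have p: "path V p" and M: "M < length p" using ext by (auto simp: extremal_def nbr_pos_def)
  have "i \<le> M" using ext i p by (auto simp: extremal_def)
  have i1: "1 \<le> i" using i nbr_pos_ge1 by blast
  have split: "[i..<length p] = [i..<M] @ [M..<length p]"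
    using M \<open>i \<le> M\<close> upt_add_eq_append[of i M "length p - M"] by auto
  have "successively (\<lambda>i j. E (p ! i) (p ! j)) (rev [0..<i] @ [i..<length p])"
    unfolding successively_append_iff
    using path_successively_upt[OF p] path_successively_rev_upt[OF p, of i 0] i
    by (auto simp: last_rev nbr_pos_def hd_upt)
  then have "successively (\<lambda>i j. E (p ! i) (p ! j)) ((rev [0..<i] @ [i..<M]) @ [M..<length p])"
    using split by simp
  then show ?thesis
    by (rule extremal_rearranged_start[OF ext, rotated 3])
      (use u i1 \<open>i \<le> M\<close> in \<open>auto simp: hd_rev hd_append\<close>)
qed

end

section \<open>Consequences of the bound \<open>l\<close> on even cycles for the neighbours of the
  start\<close>

locale even_bounded = adjacency +
  fixes l :: nat
  assumes even_l: "even l" and l_ge: "4 \<le> l"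
    and cyc_le: "cyc p \<Longrightarrow> even (length p) \<Longrightarrow> length p \<le> l"
begin

lemma cyc_reindex_le:
  assumes "path V p" "3 \<le> length js" "distinct js" "set js \<subseteq> {..<length p}"
    "successively (\<lambda>i j. E (p ! i) (p ! j)) js" "E (p ! last js) (p ! hd js)" "even (length js)"
  shows "length js \<le> l"
  using cyc_le[OF cyc_reindex[OF assms(1-6)]] assms(7) by simp

text \<open>For \<open>i\<close> at least 3, the edge back to the start closes the first
  \<open>i + 1\<close> vertices to an even cycle.\<close>

lemma odd_nbr_pos_less:
  assumes p: "path V p" and i: "i \<in> nbr_pos p" "odd i"
  shows "i < l"
proof (cases "i = 1")
  case False
  then have "3 \<le> Suc i" using nbr_pos_ge1[OF i(1)] by simp
  moreover have "i < length p" "E (p ! i) (p ! 0)" using i sym by (auto simp: nbr_pos_def)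
  ultimately have "length [0..<Suc i] \<le> l"
    using path_successively_upt[OF p, of "Suc i" 0] i(2)
    by (intro cyc_reindex_le[OF p]) (auto simp del: upt_Suc simp: hd_upt)
  then show ?thesis by simp
qed (use l_ge in simp)

text \<open>The edges from \<open>p ! 0\<close> to \<open>p ! i\<close> and \<open>p ! j\<close>
  close the segment between these two to a cycle of length \<open>j - i + 2\<close>.\<close>

lemma even_nbr_pos_diff_le:
  assumes p: "path V p" and ij: "i \<in> nbr_pos p" "j \<in> nbr_pos p" "i < j" "even (j - i)"
  shows "j + 2 \<le> i + l"
proof -
  have "1 \<le> i" using nbr_pos_ge1[OF ij(1)] .
  moreover have "j < length p" "E (p ! 0) (p ! i)" "E (p ! j) (p ! 0)"
    using ij sym by (auto simp: nbr_pos_def)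
  ultimately have "length (0 # [i..<Suc j]) \<le> l"
    using path_successively_upt[OF p, of "Suc j" i] ij(3,4)
    by (intro cyc_reindex_le[OF p])
      (auto simp del: upt_Suc simp: hd_upt successively_Cons Suc_diff_le)
  then show ?thesis using ij(3) by simp
qed

text \<open>
  The possible positions of neighbours of the start of an extremal path if the last one is at an even
  position \<open>M\<close>.
\<close>
definition slots :: "nat \<Rightarrow> nat set" where
  "slots M = (\<lambda>k. 2 * k + 1) ` {..<l div 2} \<union> (\<lambda>k. M - 2 * k) ` {..<l div 2}"

lemma finite_slots: "finite (slots M)"
  by (simp add: slots_def)

lemma card_slots_le: "card (slots M) \<le> l"
proof -
  have "card (slots M) \<le> l div 2 + l div 2"
    unfolding slots_def
    by (rule order_trans[OF card_Un_le add_mono]) (metis card_image_le card_lessThan finite_lessThan)+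
  then show ?thesis by linarith
qed

lemma odd_in_slots:
  assumes "odd i" "i < l"
  shows "i \<in> slots M"
proof -
  have "i = 2 * (i div 2) + 1" using assms(1) by presburger
  moreover have "i div 2 < l div 2" using assms even_l by presburger
  ultimately show ?thesis unfolding slots_def by blast
qed

lemma even_in_slots:
  assumes "even M" "even i" "i \<le> M" "M + 2 \<le> i + l"
  shows "i \<in> slots M"
proof -
  have "i = M - 2 * ((M - i) div 2)" using assms(1-3) by presburger
  moreover have "(M - i) div 2 < l div 2" using assms(3,4) by linarith
  ultimately show ?thesis unfolding slots_def by blast
qed

lemma nbr_pos_subset_slots:
  assumes "path V q" "M \<in> nbr_pos q" "even M" "nbr_pos q \<subseteq> {1..M}"
  shows "nbr_pos q \<subseteq> slots M"
proof
  fix i assume i: "i \<in> nbr_pos q"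
  show "i \<in> slots M"
  proof (cases "odd i")
    case True
    then show ?thesis using odd_nbr_pos_less[OF assms(1) i] odd_in_slots by blast
  next
    case False
    moreover have "i \<le> M" using assms(4) i by auto
    moreover have "M + 2 \<le> i + l"
      using even_nbr_pos_diff_le[OF assms(1) i assms(2)] False assms(3) \<open>i \<le> M\<close> l_ge
      by (cases "i = M") auto
    ultimately show ?thesis using even_in_slots assms(3) by blast
  qed
qed

lemma extremal_degree_le:
  assumes ext: "extremal V p M" and deg: "d \<le> card {u \<in> V. E (p ! 0) u}"
  shows "d \<le> l"
proof -
  have p: "path V p" "M \<in> nbr_pos p" using ext by (auto simp: extremal_def)
  note N = extremal_nbr_pos_card[OF ext p(1) refl deg]
  show ?thesis
  proof (cases "even M")
    case True
    then have "card (nbr_pos p) \<le> card (slots M)"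
      using nbr_pos_subset_slots[OF p True N(1)] finite_slots card_mono by blast
    then show ?thesis using N(2) card_slots_le[of M] by linarith
  next
    case False
    then have "M < l" using odd_nbr_pos_less[OF p] by blast
    moreover have "card (nbr_pos p) \<le> M" using card_mono[OF _ N(1)] by simp
    ultimately show ?thesis using N(2) by linarith
  qed
qed

section \<open>Minimum degree \<open>l - 1\<close>: at most one slot is free\<close>

lemma one_of_two_slots:
  assumes "nbr_pos q \<subseteq> slots M" "l - 1 \<le> card (nbr_pos q)"
    and xy: "x \<in> slots M" "y \<in> slots M" "x \<noteq> y"
  shows "x \<in> nbr_pos q \<or> y \<in> nbr_pos q"
proof (rule ccontr)
  assume "\<not> ?thesis"
  then have "nbr_pos q \<subseteq> slots M - {x, y}" using assms(1) by blast
  then have "card (nbr_pos q) \<le> card (slots M - {x, y})"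
    by (rule card_mono[rotated]) (simp add: finite_slots)
  also have "\<dots> \<le> l - 2"
    using xy card_slots_le[of M] by (simp add: card_Diff_subset)
  finally show False using assms(2) l_ge by simp
qed

text \<open>
  If the odd cycle \<open>p\<^sub>0 \<dots> p\<^sub>M\<close> is longer than \<open>l + 1\<close>, the neighbours of its vertices \<open>p\<^sub>0\<close> and
  \<open>p\<^bsub>M-1\<^esub>\<close>, at distance two on it, fill all slots but at most one each. Then one of three even
  cycles of length \<open>l + 2\<close> using a chord at each of them is present.
\<close>
lemma extremal_last_le:
  assumes ext: "extremal V p M" and l6: "6 \<le> l"
    and deg: "\<And>v. v \<in> V \<Longrightarrow> l - 1 \<le> card {u \<in> V. E v u}"
  shows "M \<le> l"
proof (rule ccontr)
  assume "\<not> M \<le> l"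
  have p: "path V p" "M \<in> nbr_pos p" using ext by (auto simp: extremal_def)
  have M: "M < length p" and p0M: "E (p ! 0) (p ! M)" using p(2) by (auto simp: nbr_pos_def)
  \<comment> \<open>An odd \<open>M\<close> would be below \<open>l\<close>; and since
    \<open>M\<close> and \<open>l\<close> are even, \<open>l < M\<close> leaves a gap of at least
    2.\<close>
  have even_M: "even M" using odd_nbr_pos_less[OF p] \<open>\<not> M \<le> l\<close> by fastforce
  then have Ml: "l + 2 \<le> M" using \<open>\<not> M \<le> l\<close> even_l by presburger
  have in_V: "p ! i \<in> V" if "i < length p" for i
    using p(1) that by (auto simp: path_def)
  \<comment> \<open>The rotation at the edge from \<open>p ! 0\<close> to \<open>p ! M\<close>
    starts at \<open>p ! (M - 1)\<close> and again has \<open>M\<close> as a neighbour position, so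
    the same slots serve for both starts.\<close>
  define q where "q = map ((!) p) (rev [0..<M] @ [M..<length p])"
  have q: "path V q"
    unfolding q_def
  proof (rule path_reindex[OF p(1)])
    show "successively (\<lambda>i j. E (p ! i) (p ! j)) (rev [0..<M] @ [M..<length p])"
      unfolding successively_append_iff
      using path_successively_upt[OF p(1)] path_successively_rev_upt[OF p(1), of M 0] M p0M
      by (auto simp: last_rev)
  qed (use M in auto)
  have lq: "length q = length p" using M by (simp add: q_def)
  have q_nth: "q ! i = p ! (M - 1 - i)" if "i < M" for i
    using that by (simp add: q_def nth_append rev_nth)
  have "q ! M = p ! M" using M by (simp add: q_def nth_append)
  then have Mq: "M \<in> nbr_pos q"
    using path_nth_adj[OF p(1), of "M - 1"] M Ml by (simp add: nbr_pos_def q_nth lq)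
  have "q ! 0 \<in> V" "p ! 0 \<in> V" using in_V[of 0] in_V[of "M - 1"] M Ml by (cases p; simp add: q_nth)+
  note Np = extremal_nbr_pos_card[OF ext p(1) refl deg[OF this(2)]]
    and Nq = extremal_nbr_pos_card[OF ext q lq deg[OF this(1)]]
  have slot_p: "x \<in> nbr_pos p \<or> y \<in> nbr_pos p" if "x \<in> slots M" "y \<in> slots M" "x \<noteq> y" for x y
    using one_of_two_slots[OF nbr_pos_subset_slots[OF p even_M Np(1)] Np(2)] that .
  have slot_q: "x \<in> nbr_pos q \<or> y \<in> nbr_pos q" if "x \<in> slots M" "y \<in> slots M" "x \<noteq> y" for x y
    using one_of_two_slots[OF nbr_pos_subset_slots[OF q Mq even_M Nq(1)] Nq(2)] that .
  have adj_p: "E (p ! 0) (p ! i)" if "i \<in> nbr_pos p" for i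
    using that by (simp add: nbr_pos_def)
  have adj_q: "E (p ! (M - 1)) (p ! (M - 1 - i))" if "i \<in> nbr_pos q" "i < M" for i
    using that Ml by (simp add: nbr_pos_def q_nth)
  note succ = successively_append_iff successively_Cons
  note upt = path_successively_upt[OF p(1)] path_successively_rev_upt[OF p(1)]
  \<comment> \<open>The cycle runs through positions 0, \<open>l - 1\<close> down to 1,
    \<open>M - 1\<close>, \<open>M\<close>.\<close>
  have not_A: "\<not> (l - 1 \<in> nbr_pos p \<and> M - 2 \<in> nbr_pos q)"
  proof
    assume A: "l - 1 \<in> nbr_pos p \<and> M - 2 \<in> nbr_pos q"
    have "E (p ! 0) (p ! (l - 1))" using A adj_p by blast
    moreover have "M - 1 - (M - 2) = 1" "M - 2 < M" using Ml by simp_all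
    with A adj_q[of "M - 2"] have "E (p ! 1) (p ! (M - 1))" by (simp add: sym)
    moreover have "E (p ! (M - 1)) (p ! M)" using path_nth_adj[OF p(1), of "M - 1"] M Ml by simp
    moreover have "length (0 # rev [1..<l] @ [M - 1, M]) = l + 2" using l_ge by simp
    ultimately have "length (0 # rev [1..<l] @ [M - 1, M]) \<le> l"
      using upt(2)[of l 1] M Ml l6 even_l sym[OF p0M]
      by (intro cyc_reindex_le[OF p(1)]) (auto simp: succ hd_append hd_rev last_rev)
    then show False by simp
  qed
  \<comment> \<open>The mirror image of \<open>not_A\<close>, with \<open>p\<close> and
    \<open>q\<close> exchanged: positions \<open>M - 1\<close>, \<open>M\<close>, 0, then
    \<open>M - 2\<close> down to \<open>M - l\<close>.\<close>
  have not_B: "\<not> (M - 2 \<in> nbr_pos p \<and> l - 1 \<in> nbr_pos q)"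
  proof
    assume B: "M - 2 \<in> nbr_pos p \<and> l - 1 \<in> nbr_pos q"
    have "E (p ! 0) (p ! (M - 2))" using B adj_p by blast
    moreover have "M - 1 - (l - 1) = M - l" "l - 1 < M" using Ml l_ge by simp_all
    with B adj_q[of "l - 1"] have "E (p ! (M - l)) (p ! (M - 1))" by (simp add: sym)
    moreover have "E (p ! (M - 1)) (p ! M)" using path_nth_adj[OF p(1), of "M - 1"] M Ml by simp
    moreover have "length ([M - 1, M, 0] @ rev [M - l..<M - 1]) = l + 2" using l_ge Ml by simp
    moreover have "last [M - l..<M - 1] = M - 2" using l_ge Ml by (simp add: last_upt)
    ultimately have "length ([M - 1, M, 0] @ rev [M - l..<M - 1]) \<le> l"
      using upt(2)[of "M - 1" "M - l"] M Ml l6 even_l sym[OF p0M]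
      by (intro cyc_reindex_le[OF p(1)]) (auto simp: succ hd_append hd_rev last_rev)
    then show False using Ml by simp
  qed
  \<comment> \<open>The cycle runs through positions 0 to 3, then \<open>M - 1\<close> down to
    \<open>M + 2 - l\<close>. The two segments are disjoint because
    \<open>l + 2 \<le> M\<close>.\<close>
  have not_C: "\<not> (M + 2 - l \<in> nbr_pos p \<and> M - 4 \<in> nbr_pos q)"
  proof
    assume C: "M + 2 - l \<in> nbr_pos p \<and> M - 4 \<in> nbr_pos q"
    have "E (p ! (M + 2 - l)) (p ! 0)" using C adj_p sym by blast
    moreover have "M - 1 - (M - 4) = 3" "M - 4 < M" using Ml l_ge by simp_all
    with C adj_q[of "M - 4"] have "E (p ! 3) (p ! (M - 1))" by (simp add: sym)
    moreover have "length ([0..<4] @ rev [M + 2 - l..<M]) = l + 2" using l_ge Ml by simp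
    moreover have "last [0..<4] = (3::nat)" "last [M + 2 - l..<M] = M - 1" "hd [M + 2 - l..<M] = M + 2 - l"
      using l_ge Ml by (simp_all add: last_upt)
    ultimately have "length ([0..<4] @ rev [M + 2 - l..<M]) \<le> l"
      using upt(1)[of 4 0] upt(2)[of M "M + 2 - l"] M Ml l6 even_l
      by (intro cyc_reindex_le[OF p(1)])
        (auto simp: successively_append_iff hd_append hd_rev last_rev simp del: upt_rec_numeral)
    then show False using Ml by simp
  qed
  have "l - 1 \<in> slots M" by (rule odd_in_slots) (use l_ge even_l in auto)
  moreover have "i \<in> slots M" if "i = M - 2 \<or> i = M - 4 \<or> i = M + 2 - l" for i
    by (rule even_in_slots[OF even_M]) (use that l6 Ml even_l even_M in auto)
  ultimately have s: "l - 1 \<in> slots M" "M - 2 \<in> slots M" "M - 4 \<in> slots M" "M + 2 - l \<in> slots M"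
    by blast+
  \<comment> \<open>\<open>M - 4\<close> and \<open>M + 2 - l\<close> coincide for
    \<open>l = 6\<close>, so this pair is not listed; one is asked about \<open>q\<close>, the other
    about \<open>p\<close>.\<close>
  have ne: "l - 1 \<noteq> M - 2" "l - 1 \<noteq> M - 4" "l - 1 \<noteq> M + 2 - l" "M - 2 \<noteq> M - 4" "M - 2 \<noteq> M + 2 - l"
  proof -
    have "odd (l - 1)" "even (M - 2)" "even (M - 4)" "even (M + 2 - l)"
      using l_ge Ml even_l even_M by auto
    then show "l - 1 \<noteq> M - 2" "l - 1 \<noteq> M - 4" "l - 1 \<noteq> M + 2 - l" by metis+
  qed (use l6 Ml in linarith)+
  \<comment> \<open>If \<open>M - 4\<close> were free for \<open>q\<close>, then
    \<open>l - 1\<close> and \<open>M - 2\<close> would be taken there, and \<open>not_A\<close> and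
    \<open>not_B\<close> would free both for \<open>p\<close>. The next claim is symmetric.\<close>
  have "M - 4 \<in> nbr_pos q"
    using not_A not_B slot_p[OF s(1,2) ne(1)] slot_q[OF s(1,3) ne(2)] slot_q[OF s(2,3) ne(4)] by blast
  moreover have "M + 2 - l \<in> nbr_pos p"
    using not_A not_B slot_p[OF s(1,4) ne(3)] slot_p[OF s(2,4) ne(5)] slot_q[OF s(1,2) ne(1)] by blast
  ultimately show False using not_C by blast
qed

text \<open>This leaves \<open>p ! M\<close> as the only vertex of the prefix that can have
  neighbours outside it. If \<open>Suc j\<close> is a neighbour position, a rotation starts at
  \<open>p ! j\<close>. Otherwise it is the only position missing from \<open>{1..M}\<close>, and
  \<open>M = l\<close>.\<close>

lemma extremal_prefix_closed:
  assumes ext: "extremal V p M" and l6: "6 \<le> l"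
    and deg: "\<And>v. v \<in> V \<Longrightarrow> l - 1 \<le> card {u \<in> V. E v u}"
    and j: "j < M" and u: "u \<in> V" "E (p ! j) u"
  shows "u \<in> (!) p ` {..M}"
proof (cases "Suc j \<in> nbr_pos p")
  case True
  then show ?thesis using extremal_rotated_start[OF ext True] u by simp
next
  case False
  have p: "path V p" "M \<in> nbr_pos p" using ext by (auto simp: extremal_def)
  have M: "M < length p" using p(2) by (auto simp: nbr_pos_def)
  have in_V: "p ! i \<in> V" if "i < length p" for i
    using p(1) that by (auto simp: path_def)
  have "p ! 0 \<in> V" using in_V M by force
  note N = extremal_nbr_pos_card[OF ext p(1) refl deg[OF this]]
  have Ml: "M \<le> l" using extremal_last_le[OF ext l6 deg] .
  have others: "M = l \<and> i \<in> nbr_pos p" if "i \<in> {1..M}" "i \<noteq> Suc j" for i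
  proof -
    have sub: "nbr_pos p \<subseteq> {1..M} - {Suc j}" using N(1) False by blast
    have "card ({1..M} - {Suc j}) = M - 1" using j by simp
    moreover have "card (nbr_pos p) \<le> card ({1..M} - {Suc j})" by (rule card_mono[OF _ sub]) simp
    ultimately have "l - 1 \<le> M - 1" "card ({1..M} - {Suc j}) \<le> l - 1"
      using N(2) Ml by linarith+
    then have "M = l" "nbr_pos p = {1..M} - {Suc j}"
      using Ml l_ge card_seteq[OF _ sub] N(2) by auto
    then show ?thesis using that by blast
  qed
  have "M \<noteq> Suc j" using p(2) False by blast
  have M_eq: "M = l" using others[of M] \<open>M \<noteq> Suc j\<close> j by simp
  have "1 \<in> nbr_pos p" using path_nth_adj[OF p(1), of 0] M j by (simp add: nbr_pos_def)
  then have j1: "1 \<le> j" using False by (cases j) auto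
  have jM: "Suc j < M" using j \<open>M \<noteq> Suc j\<close> by simp
  have j2: "j + 2 \<in> nbr_pos p" using others[of "j + 2"] jM by simp
  \<comment> \<open>No rotation starts at \<open>p\<^sub>j\<close>, but \<open>p\<^bsub>j+1\<^esub>\<close> misses only \<open>p\<^sub>0\<close>, which gives another path
      through \<open>p\<^sub>0, \<dots>, p\<^sub>M\<close> from \<open>p\<^sub>j\<close> to \<open>p\<^sub>M\<close>.\<close>
  have full: "E (p ! Suc j) (p ! i)" if i: "i \<le> M" "i \<noteq> 0" "i \<noteq> Suc j" for i
  proof -
    \<comment> \<open>The rotation at \<open>j + 2\<close> starts at \<open>p ! Suc j\<close>, so
      its neighbours lie in the prefix. Without itself and \<open>p ! 0\<close> only
      \<open>l - 1\<close> candidates remain, as many as its degree requires.\<close>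
    let ?N = "{u \<in> V. E (p ! Suc j) u}" and ?A = "(!) p ` ({1..M} - {Suc j})"
    have "?N \<subseteq> ?A"
    proof
      fix w assume w: "w \<in> ?N"
      then have "w \<in> (!) p ` {..M}" using extremal_rotated_start[OF ext j2, of w] by simp
      then obtain m where m: "m \<le> M" "w = p ! m" by auto
      have "m \<noteq> Suc j" using m w irrefl by auto
      moreover have "m \<noteq> 0" using m w False sym[of "p ! Suc j" "p ! m"] jM M by (cases m) (auto simp: nbr_pos_def)
      ultimately show "w \<in> ?A" using m by auto
    qed
    moreover have "card ?A \<le> l - 1"
      using card_image_le[of "{1..M} - {Suc j}" "(!) p"] jM M_eq by simp
    moreover have "l - 1 \<le> card ?N" using deg in_V jM M by simp
    ultimately have "?N = ?A" by (intro card_seteq) auto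
    then show ?thesis using i by auto
  qed
  have e02: "E (p ! 0) (p ! (j + 2))" using j2 by (simp add: nbr_pos_def)
  note succ = successively_append_iff successively_Cons
  note upt = path_successively_upt[OF p(1)] path_successively_rev_upt[OF p(1)]
  have adj: "E (p ! i) (p ! Suc i)" if "i < M" for i
    using path_nth_adj[OF p(1)] M that by simp
  show ?thesis
  proof (cases "j = 1")
    case False
    then have "2 \<le> j" using j1 by simp
    have split: "[j + 2..<length p] = [j + 2..<M] @ [M..<length p]"
      using jM M upt_add_eq_append[of "j + 2" M "length p - M"] by auto
    \<comment> \<open>The step from \<open>Suc j\<close> to \<open>j - 1\<close> is a chord from
      \<open>full\<close>, which needs \<open>j - 1\<close> to be nonzero; the step from 0 to
      \<open>j + 2\<close> is \<open>e02\<close>.\<close>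
    define ks where "ks = [j, Suc j] @ rev [0..<j] @ [j + 2..<M]"
    have "E (p ! Suc j) (p ! (j - 1))" using full[of "j - 1"] \<open>2 \<le> j\<close> j by simp
    moreover have "last [0..<j] = j - 1" "hd [0..<j] = 0" "hd [j + 2..<length p] = j + 2"
      using \<open>2 \<le> j\<close> jM M by (simp_all add: last_upt)
    ultimately have "successively (\<lambda>i j. E (p ! i) (p ! j)) ([j, Suc j] @ rev [0..<j] @ [j + 2..<length p])"
      using upt(1)[of "length p" "j + 2"] upt(2)[of j 0] e02 adj[of j] j M \<open>2 \<le> j\<close>
      by (simp add: succ hd_append hd_rev last_rev)
    then have succ_ks: "successively (\<lambda>i j. E (p ! i) (p ! j)) (ks @ [M..<length p])"
      using split by (simp add: ks_def)
    have "hd ks = j" "ks \<noteq> []" "distinct ks" "set ks = {..<M}"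
      using jM by (auto simp: ks_def)
    then show ?thesis
      using extremal_rearranged_start[OF ext _ _ _ succ_ks u(1)] u(2) by simp
  next
    case True
    \<comment> \<open>\<open>p\<^sub>0\<close> and \<open>p\<^sub>2\<close> are not adjacent here, so the path of the other case breaks.\<close>
    have split: "[4..<length p] = [4..<M] @ [M..<length p]"
      using l6 M_eq M upt_add_eq_append[of 4 M "length p - M"] by auto
    \<comment> \<open>The chords used are from 0 to 3 by \<open>e02\<close> and from 2 to 4 by
      \<open>full\<close>.\<close>
    define ks where "ks = [1, 0, 3, 2] @ [4..<M]"
    have "E (p ! 2) (p ! 4)" using full[of 4] True M_eq l6 by (simp add: numeral_2_eq_2)
    moreover have "E (p ! 0) (p ! 3)" using e02 True by (simp add: numeral_3_eq_3)
    moreover have "E (p ! 1) (p ! 0)" "E (p ! 3) (p ! 2)"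
      using adj[of 0] adj[of 2] l6 M_eq sym by (simp_all add: numeral_3_eq_3 numeral_2_eq_2)
    moreover have "hd [4..<length p] = 4" using l6 M_eq M by simp
    ultimately have "successively (\<lambda>i j. E (p ! i) (p ! j)) ([1, 0, 3, 2] @ [4..<length p])"
      using upt(1)[of "length p" 4] by (simp add: succ)
    then have succ_ks: "successively (\<lambda>i j. E (p ! i) (p ! j)) (ks @ [M..<length p])"
      using split by (simp add: ks_def)
    have "hd ks = j" "ks \<noteq> []" "distinct ks" "set ks = {..<M}"
      using True l6 M_eq by (auto simp: ks_def)
    then show ?thesis
      using extremal_rearranged_start[OF ext _ _ _ succ_ks u(1)] u(2) by simp
  qed
qed

section \<open>From critical sets to colourings and cliques\<close>

lemma critical_extremal:
  assumes "critical V k" "1 \<le> k"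
  obtains p M where "extremal V p M"
proof (rule extremal_exists)
  show "finite V" "V \<noteq> {}" using assms critical_nonempty by (auto simp: critical_def)
  show "\<exists>u\<in>V. E v u" if "v \<in> V" for v
  proof -
    have "{u \<in> V. E v u} \<noteq> {}"
      using critical_min_degree[OF assms(1) that] assms(2) by (metis card.empty not_one_le_zero order_trans)
    then show ?thesis by blast
  qed
qed (use that in blast)

lemma critical_le:
  assumes "critical V k"
  shows "k \<le> l"
proof (cases "k = 0")
  case False
  then obtain p M where ext: "extremal V p M" using critical_extremal[OF assms] by auto
  then have "p ! 0 \<in> V" by (auto simp: extremal_def path_def)
  then show ?thesis using extremal_degree_le[OF ext critical_min_degree[OF assms]] by simp
qed simp

text \<open>If the prefix up to \<open>p ! M\<close> were not all of \<open>V\<close>, then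
  \<open>p ! M\<close> would be a cut vertex.\<close>

lemma critical_card_le:
  assumes crit: "critical V k" and k: "l - 1 \<le> k" and l6: "6 \<le> l"
  shows "card V \<le> l + 1"
proof -
  obtain p M where ext: "extremal V p M" by (rule critical_extremal[OF crit]) (use k l6 in auto)
  have p: "path V p" "M \<in> nbr_pos p" using ext by (auto simp: extremal_def)
  have M: "M < length p" "1 \<le> M" using p(2) nbr_pos_ge1 by (auto simp: nbr_pos_def)
  have deg: "l - 1 \<le> card {u \<in> V. E v u}" if "v \<in> V" for v
    using critical_min_degree[OF crit that] k by simp
  have inj: "inj_on ((!) p) {..M}" using p(1) M by (simp add: path_def inj_on_nth)
  have "(!) p ` {..M} = V"
  proof (rule critical_no_cutvertex[OF crit, where x = "p ! M"])
    show "(!) p ` {..M} \<subseteq> V" using p(1) M by (auto simp: path_def)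
    show "(!) p ` {..M} \<noteq> {p ! M}" using inj_onD[OF inj, of 0 M] M(2) by auto
    show "v \<in> (!) p ` {..M}" if "u \<in> (!) p ` {..M} - {p ! M}" "v \<in> V" "E u v" for u v
    proof -
      obtain j where "j \<le> M" "u = p ! j" "j \<noteq> M" using \<open>u \<in> _\<close> by auto
      then show ?thesis
        using extremal_prefix_closed[OF ext l6 deg, of j v] \<open>v \<in> V\<close> \<open>E u v\<close> by simp
    qed
  qed simp
  then have "card V = Suc M" using card_image[OF inj] by simp
  then show ?thesis using extremal_last_le[OF ext l6 deg] by simp
qed

lemma colorable_Suc_bound:
  assumes "finite V"
  shows "colorable V (l + 1)"
proof (rule ccontr)
  assume "\<not> ?thesis"
  then obtain W where "critical W (l + 1)" using critical_subset_exists assms by metis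
  then show False using critical_le by fastforce
qed

text \<open>A critical set has at most \<open>l + 1\<close> vertices and all degrees at least
  \<open>l\<close>, so it is complete.\<close>

lemma clique_if_not_colorable:
  assumes "finite V" "6 \<le> l" "\<not> colorable V l"
  obtains K where "K \<subseteq> V" "card K = l + 1" "\<And>u v. u \<in> K \<Longrightarrow> v \<in> K \<Longrightarrow> u \<noteq> v \<Longrightarrow> E u v"
proof -
  obtain W where W: "W \<subseteq> V" "critical W l" using critical_subset_exists assms(1,3) by metis
  have fin: "finite W" using W(2) by (simp add: critical_def)
  have cW: "card W \<le> l + 1" using critical_card_le[OF W(2)] assms(2) by simp
  have nbrs: "l \<le> card (W - {v}) \<and> {u \<in> W. E v u} = W - {v}" if "v \<in> W" for v
  proof -
    have sub: "{u \<in> W. E v u} \<subseteq> W - {v}" using irrefl by auto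
    have deg: "l \<le> card {u \<in> W. E v u}" by (rule critical_min_degree[OF W(2) that])
    have "card (W - {v}) \<le> l" using cW that fin by simp
    then have "{u \<in> W. E v u} = W - {v}" using card_seteq[OF _ sub] deg fin by simp
    then show ?thesis using deg by simp
  qed
  obtain v where "v \<in> W" using critical_nonempty[OF W(2)] by blast
  then have "l + 1 \<le> card W" using conjunct1[OF nbrs[OF \<open>v \<in> W\<close>]] fin l_ge by auto
  then have "card W = l + 1" using cW by simp
  moreover have "E u v" if "u \<in> W" "v \<in> W" "u \<noteq> v" for u v
    using nbrs[OF that(1)] that by auto
  ultimately show ?thesis using that W(1) by blast
qed

text \<open>In a critical set \<open>W\<close> each vertex misses at most one other, so non-adjacent
  pairs are disjoint. Two such pairs would permit a colouring with \<open>l - 1\<close> colours;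
  hence there is at most one, and deleting one of its ends leaves a clique.\<close>

lemma clique_if_not_colorable_pred:
  assumes "finite V" "6 \<le> l" "\<not> colorable V (l - 1)"
  obtains K where "K \<subseteq> V" "card K = l" "\<And>u v. u \<in> K \<Longrightarrow> v \<in> K \<Longrightarrow> u \<noteq> v \<Longrightarrow> E u v"
proof -
  obtain W where W: "W \<subseteq> V" "critical W (l - 1)" using critical_subset_exists assms(1,3) by metis
  have fin: "finite W" using W(2) by (simp add: critical_def)
  have cW: "card W \<le> l + 1" using critical_card_le[OF W(2)] assms(2) by simp
  have missing: "card W = l + 1 \<and> a = b"
    if "v \<in> W" "a \<in> W" "b \<in> W" "a \<noteq> v" "b \<noteq> v" "\<not> E v a" "\<not> E v b" for v a b
  proof -
    have "{u \<in> W. E v u} \<subseteq> W - {v, a, b}" using that irrefl by auto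
    then have "card {u \<in> W. E v u} \<le> card (W - {v, a, b})" using fin card_mono by blast
    also have "\<dots> = card W - card {v, a, b}" using that fin by (simp add: card_Diff_subset)
    finally have "l - 1 \<le> card W - card {v, a, b}"
      using critical_min_degree[OF W(2) that(1)] by simp
    \<comment> \<open>Three removed vertices would leave at most \<open>l - 2\<close>; two leave
      \<open>l - 1\<close> only if \<open>W\<close> has \<open>l + 1\<close>.\<close>
    then show ?thesis using that cW l_ge by (cases "a = b") auto
  qed
  have lW: "l \<le> card W"
  proof -
    obtain v where v: "v \<in> W" using critical_nonempty[OF W(2)] by blast
    have "{u \<in> W. E v u} \<subseteq> W - {v}" using irrefl by auto
    then have "card {u \<in> W. E v u} \<le> card (W - {v})" using fin card_mono by blast
    then show ?thesis using critical_min_degree[OF W(2) v] v fin l_ge by simp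
  qed
  show ?thesis
  proof (cases "\<forall>u\<in>W. \<forall>v\<in>W. u \<noteq> v \<longrightarrow> E u v")
    case True
    obtain K where K: "K \<subseteq> W" "card K = l" using obtain_subset_with_card_n[OF lW] by blast
    show ?thesis
    proof (rule that)
      show "K \<subseteq> V" using K(1) W(1) by (rule order_trans)
      show "E u v" if "u \<in> K" "v \<in> K" "u \<noteq> v" for u v
        using True K(1) that by (simp add: subset_eq)
    qed (fact K(2))
  next
    case False
    then obtain x y where xy: "x \<in> W" "y \<in> W" "x \<noteq> y" "\<not> E x y" by blast
    have card_W: "card W = l + 1" using missing[OF xy(1,2,2)] xy by blast
    have "E u v" if uv: "u \<in> W - {x}" "v \<in> W - {x}" "u \<noteq> v" for u v
    proof (rule ccontr)
      assume nE: "\<not> E u v"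
      have "u \<noteq> y" using missing[of y x v] xy uv nE sym by blast
      have "v \<noteq> y" using missing[of y x u] xy uv nE sym by blast
      have card_D: "card (W - {y, v}) = l - 1"
        using xy uv fin card_W \<open>v \<noteq> y\<close> by (simp add: card_Diff_subset)
      then obtain c where c: "bij_betw c (W - {y, v}) {0..<l - 1}"
        using ex_bij_betw_finite_nat[of "W - {y, v}"] fin by auto
      have c_less: "c w < l - 1" if "w \<in> W" "w \<noteq> y" "w \<noteq> v" for w
        using bij_betw_apply[OF c, of w] that by simp
      have c_inj: "w = w'" if "c w = c w'" "w \<in> W - {y, v}" "w' \<in> W - {y, v}" for w w'
        using c that by (meson bij_betw_imp_inj_on inj_onD)
      \<comment> \<open>\<open>r\<close> merges \<open>y\<close> into \<open>x\<close> and
        \<open>v\<close> into \<open>u\<close>; the \<open>l - 1\<close> remaining representatives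
        get distinct colours.\<close>
      define r where "r = (\<lambda>w. if w = y then x else if w = v then u else w)"
      have r_in: "r w \<in> W - {y, v}" if "w \<in> W" for w
        using that xy uv \<open>u \<noteq> y\<close> by (auto simp: r_def)
      have r_eq: "\<not> E w w'" if "r w = r w'" for w w'
        using that irrefl xy(4) nE sym uv by (auto simp: r_def split: if_splits)
      have "colorable W (l - 1)"
        unfolding colorable_def
      proof (intro exI[of _ "\<lambda>w. c (r w)"] conjI ballI impI)
        show "c (r w) < l - 1" if "w \<in> W" for w using c_less r_in[OF that] by blast
        show "c (r w) \<noteq> c (r w')" if "w \<in> W" "w' \<in> W" "E w w'" for w w'
          using c_inj[OF _ r_in r_in] r_eq that by blast
      qed
      then show False using W(2) by (simp add: critical_def)
    qed
    moreover have "card (W - {x}) = l" using card_W xy(1) fin by simp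
    moreover have "W - {x} \<subseteq> V" using W(1) by blast
    ultimately show ?thesis using that by blast
  qed
qed

end

section \<open>Transfer to \<open>pair_graph\<close>\<close>

context pair_graph
begin

definition adj :: "'a \<Rightarrow> 'a \<Rightarrow> bool" where
  "adj u v \<longleftrightarrow> (u, v) \<in> parcs G"

sublocale adjacency adj
  using pair_sym_arcs no_loops' by unfold_locales (auto simp: adj_def symmetric_def dest: symD)

lemma vwalk_arcs_cas:
  "xs \<noteq> [] \<Longrightarrow> pcas (hd xs) (vwalk_arcs xs) (last xs)"
  by (induction xs rule: vwalk_arcs.induct) auto

lemma awalk_verts_vwalk_arcs:
  "xs \<noteq> [] \<Longrightarrow> pawalk_verts (hd xs) (vwalk_arcs xs) = xs"
  by (induction xs rule: vwalk_arcs.induct) auto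

lemma set_vwalk_arcs_subset:
  "successively adj xs \<Longrightarrow> set (vwalk_arcs xs) \<subseteq> parcs G"
  by (induction xs rule: vwalk_arcs.induct) (auto simp: adj_def)

text \<open>\<open>cyc\<close> lists vertices, \<open>cycle\<close> lists arcs. Repeating the head
  at the end closes the walk and yields as many arcs as vertices.\<close>

lemma cyc_ugraph_cycle:
  assumes "cyc xs"
  shows "\<exists>p. ugraph_cycle G p \<and> length p = length xs"
proof -
  let ?ys = "xs @ [hd xs]" and ?p = "vwalk_arcs (xs @ [hd xs])"
  have xs: "xs \<noteq> []" "distinct xs" "3 \<le> length xs" using assms by (auto simp: cyc_def)
  have "successively adj ?ys" using assms by (simp add: cyc_def successively_append_iff)
  then have arcs: "set ?p \<subseteq> parcs G" by (rule set_vwalk_arcs_subset)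
  have len: "length ?p = length xs" using vwalk_length_simp[of ?ys, unfolded vwalk_length_def] by simp
  have hd: "hd ?ys = hd xs" using xs(1) by simp
  have cas: "pcas (hd xs) ?p (hd xs)" using vwalk_arcs_cas[of ?ys] hd by simp
  have verts: "pawalk_verts (hd xs) ?p = ?ys" using awalk_verts_vwalk_arcs[of ?ys] hd by simp
  \<comment> \<open>\<open>awalk\<close> also requires the start to be a vertex of \<open>G\<close>;
    it is the tail of this arc.\<close>
  have "(hd xs, hd (tl xs)) \<in> parcs G"
    using xs assms by (cases xs rule: vwalk_arcs.cases) (auto simp: cyc_def adj_def)
  then have "awalk (hd xs) ?p (hd xs)"
    using in_arcsD1 arcs cas by (simp add: awalk_def)
  moreover have "distinct (tl (pawalk_verts (hd xs) ?p))"
    unfolding verts using xs(1,2) by (cases xs) auto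
  moreover have "?p \<noteq> []" using len xs by force
  ultimately have "cycle ?p" unfolding cycle_def by blast
  then show ?thesis using len xs(3) by (auto simp: ugraph_cycle_def)
qed

lemma chromatic_number_le:
  assumes "colorable (pverts G) k"
  shows "chromatic_number G \<le> k"
proof -
  obtain c where "\<forall>v\<in>pverts G. c v < k" "\<forall>u\<in>pverts G. \<forall>v\<in>pverts G. adj u v \<longrightarrow> c u \<noteq> c v"
    using assms by (auto simp: colorable_def)
  then have "proper_coloring G k c"
    using in_arcsD1 in_arcsD2 by (fastforce simp: proper_coloring_def adj_def)
  then show ?thesis unfolding chromatic_number_def by (intro Least_le) blast
qed

lemma card_clique_le:
  assumes "K \<subseteq> pverts G" "\<And>u v. u \<in> K \<Longrightarrow> v \<in> K \<Longrightarrow> u \<noteq> v \<Longrightarrow> adj u v"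
  shows "card K \<le> clique_number G"
proof -
  have "{card K | K. is_clique G K} \<subseteq> card ` Pow (pverts G)"
    by (auto simp: is_clique_def)
  then have "finite {card K | K. is_clique G K}"
    by (rule finite_subset) (simp add: pair_finite_verts)
  moreover have "is_clique G K" using assms by (auto simp: is_clique_def adj_def)
  ultimately show ?thesis unfolding clique_number_def by (intro Max_ge) auto
qed

lemma longest_even_cycle_bounds:
  assumes "even_cycle_lengths G \<noteq> {}"
  shows "even_bounded adj (longest_even_cycle G)"
proof
  have "longest_even_cycle G \<in> even_cycle_lengths G"
    using assms by (rule longest_even_cycle_in)
  then show "even (longest_even_cycle G)" "4 \<le> longest_even_cycle G"
    by (auto simp: even_cycle_lengths_def ugraph_cycle_def elim!: evenE)
  show "length p \<le> longest_even_cycle G" if "cyc p" "even (length p)" for p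
    using cyc_ugraph_cycle[OF that(1)] that(2) finite_even_cycle_lengths
    unfolding longest_even_cycle_def by (intro Max_ge) (auto simp: even_cycle_lengths_def)
qed

text \<open>Even cycles have length at least 4, so a maximum below 6 would leave 4 as the only
  length.\<close>

lemma longest_even_cycle_ge_6:
  assumes "3 \<le> card (even_cycle_lengths G)"
  shows "6 \<le> longest_even_cycle G"
proof (rule ccontr)
  assume less: "\<not> ?thesis"
  have sub: "even_cycle_lengths G \<subseteq> {4}"
  proof
    fix m assume m: "m \<in> even_cycle_lengths G"
    then have "m \<le> longest_even_cycle G"
      unfolding longest_even_cycle_def using finite_even_cycle_lengths by (rule Max_ge[rotated])
    moreover have "even m" "3 \<le> m" using m by (auto simp: even_cycle_lengths_def ugraph_cycle_def)
    ultimately show "m \<in> {4}" using less by simp presburger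
  qed
  have "card (even_cycle_lengths G) \<le> 1"
    using card_mono[OF _ sub] by simp
  then show False using assms by simp
qed

end

theorem theorem10:
  fixes G :: "'a pair_pre_digraph"
  assumes "pair_graph G"
    and "Digraph_Component.connected (with_proj G)"
    and "\<exists>p. ugraph_cycle G p \<and> even (length p)"
  shows "chromatic_number G \<le> longest_even_cycle G + 1 \<and>
    (clique_number G \<le> longest_even_cycle G \<and> card (even_cycle_lengths G) \<ge> 3
       \<longrightarrow> chromatic_number G \<le> longest_even_cycle G) \<and>
    (clique_number G \<le> longest_even_cycle G - 1 \<and> card (even_cycle_lengths G) \<ge> 3
       \<longrightarrow> chromatic_number G \<le> longest_even_cycle G - 1)"
proof -
  interpret pair_graph G by fact
  have "even_cycle_lengths G \<noteq> {}" using assms(3) by (auto simp: even_cycle_lengths_def)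
  then interpret even_bounded adj "longest_even_cycle G"
    by (rule longest_even_cycle_bounds)
  show ?thesis
  proof (intro conjI impI; (elim conjE)?)
    show "chromatic_number G \<le> longest_even_cycle G + 1"
      using chromatic_number_le colorable_Suc_bound pair_finite_verts by blast
  next
    assume w: "clique_number G \<le> longest_even_cycle G" and L: "3 \<le> card (even_cycle_lengths G)"
    have "colorable (pverts G) (longest_even_cycle G)"
    proof (rule ccontr)
      assume "\<not> ?thesis"
      then obtain K where "K \<subseteq> pverts G" "card K = longest_even_cycle G + 1"
        "\<And>u v. u \<in> K \<Longrightarrow> v \<in> K \<Longrightarrow> u \<noteq> v \<Longrightarrow> adj u v"
        using clique_if_not_colorable[OF pair_finite_verts longest_even_cycle_ge_6[OF L]] by metis
      then show False using card_clique_le[of K] w by simp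
    qed
    then show "chromatic_number G \<le> longest_even_cycle G" by (rule chromatic_number_le)
  next
    assume w: "clique_number G \<le> longest_even_cycle G - 1" and L: "3 \<le> card (even_cycle_lengths G)"
    have "colorable (pverts G) (longest_even_cycle G - 1)"
    proof (rule ccontr)
      assume "\<not> ?thesis"
      then obtain K where "K \<subseteq> pverts G" "card K = longest_even_cycle G"
        "\<And>u v. u \<in> K \<Longrightarrow> v \<in> K \<Longrightarrow> u \<noteq> v \<Longrightarrow> adj u v"
        using clique_if_not_colorable_pred[OF pair_finite_verts longest_even_cycle_ge_6[OF L]] by metis
      then show False using card_clique_le[of K] w l_ge by simp
    qed
    then show "chromatic_number G \<le> longest_even_cycle G - 1" by (rule chromatic_number_le)
  qed
qed

end
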